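(* Let $r \geq 1$ and let $W_r(k;s)$ be as in the context. (i) For real $k$ with $|k| > 2^r$ and all $s \in \mathbb{C}$, $$W_r(k;s) = |k|^s \cdot {}_{r+1} F_{r} \left( \tfrac{-s}{2}, \tfrac{1-s}{2}, \tfrac{1}{2}, \dots , \tfrac{1}{2}; 1, \dots, 1; \tfrac{4^r}{k^2} \right).$$ (ii) For real $k$ with $|k| = 2^r$ and $\operatorname{Re}(s) > -\frac{r}{2}$, $$W_r(k;s) = 2^{rs}\, {}_{r+1} F_{r} \left( \tfrac{-s}{2}, \tfrac{1-s}{2}, \tfrac{1}{2}, \dots , \tfrac{1}{2}; 1, \dots, 1; 1 \right).$$ (In both formulas there are $r-1$ upper parameters equal to $\frac12$ and $r$ lower parameters equal to $1$.)
   Context: For $r\ge 1$, real $k$ and complex $s$, $$W_r(k;s) = \frac{1}{(2 \pi i)^r} \int_{\mathbb{T}^r} \left|k + (x_1 + x_1^{-1}) \cdots (x_r + x_r^{-1}) \right|^s \frac{dx_1}{x_1} \cdots \frac{dx_r}{x_r},$$ where $\mathbb{T}^r$ is the unit torus in $\mathbb{C}^r$; defined by this integral where it converges and extended in $s$ by analytic continuation. ${}_{r+1}F_r$ denotes the generalized hypergeometric series $\sum_{n\ge0}\frac{(a_1)_n\cdots(a_{r+1})_n}{(b_1)_n\cdots(b_r)_n}\frac{z^n}{n!}$, $(x)_n=x(x+1)\cdots(x+n-1)$. *)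

theory Defs
  imports "HOL-Analysis.Analysis"
begin

(* The unit torus in r complex dimensions is parametrised by x j = cis (t j) with t j in [0, 2 pi],
   so that dx j = i x j dt j.  Points are functions on {..<r}. *)

definition torus_measure :: "nat \<Rightarrow> (nat \<Rightarrow> real) measure" where
  "torus_measure r = PiM {..<r} (\<lambda>_. lborel)"

definition torus_box :: "nat \<Rightarrow> (nat \<Rightarrow> real) set" where
  "torus_box r = ({..<r} \<rightarrow>\<^sub>E {0..2*pi})"

definition torus_pullback :: "nat \<Rightarrow> ((nat \<Rightarrow> complex) \<Rightarrow> complex) \<Rightarrow> (nat \<Rightarrow> real) \<Rightarrow> complex" where
  "torus_pullback r F t = F (\<lambda>j. cis (t j)) * (\<Prod>j<r. \<i> * cis (t j))"

definition torus_integrable :: "nat \<Rightarrow> ((nat \<Rightarrow> complex) \<Rightarrow> complex) \<Rightarrow> bool" where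
  "torus_integrable r F \<longleftrightarrow> set_integrable (torus_measure r) (torus_box r) (torus_pullback r F)"

definition torus_integral :: "nat \<Rightarrow> ((nat \<Rightarrow> complex) \<Rightarrow> complex) \<Rightarrow> complex" where
  "torus_integral r F = set_lebesgue_integral (torus_measure r) (torus_box r) (torus_pullback r F)"

(* Where the base of the power vanishes (a null set of the torus if r > 0), 0 powr s = 0. *)
definition W_integrand :: "nat \<Rightarrow> real \<Rightarrow> complex \<Rightarrow> (nat \<Rightarrow> complex) \<Rightarrow> complex" where
  "W_integrand r k s x =
     complex_of_real (cmod (of_real k + (\<Prod>j<r. x j + inverse (x j)))) powr s * (\<Prod>j<r. 1 / x j)"

definition W_integral :: "nat \<Rightarrow> real \<Rightarrow> complex \<Rightarrow> complex" where
  "W_integral r k s = 1 / (2 * of_real pi * \<i>) ^ r * torus_integral r (W_integrand r k s)"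

(* w is the value at s of a holomorphic function on some domain that extends the integral.
   For Re z > 0 the integrand is bounded, so the integral converges there for every k. *)
definition W_continuation_value :: "nat \<Rightarrow> real \<Rightarrow> complex \<Rightarrow> complex \<Rightarrow> bool" where
  "W_continuation_value r k s w \<longleftrightarrow>
     (\<exists>D f. open D \<and> connected D \<and> s \<in> D \<and> {z. Re z > 0} \<subseteq> D \<and> f holomorphic_on D \<and>
        (\<forall>z. Re z > 0 \<longrightarrow> f z = W_integral r k z) \<and> w = f s)"

(* Unspecified at points that no continuation reaches (the poles in s). *)
definition W :: "nat \<Rightarrow> real \<Rightarrow> complex \<Rightarrow> complex" where
  "W r k s =
     (if torus_integrable r (W_integrand r k s) then W_integral r k s
      else (THE w. W_continuation_value r k s w))"

definition hypergeometric :: "complex list \<Rightarrow> complex list \<Rightarrow> complex \<Rightarrow> complex" where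
  "hypergeometric as bs z = eval_fps (fps_hypergeo as bs 1) z"

lemma hypergeometric_series:
  "hypergeometric as bs z =
     (\<Sum>n. (\<Prod>a\<leftarrow>as. pochhammer a n) / (\<Prod>b\<leftarrow>bs. pochhammer b n) * z ^ n / fact n)"
proof -
  have "foldl (\<lambda>r a. r * pochhammer a n) c xs = c * (\<Prod>a\<leftarrow>xs. pochhammer a n)"
    for c :: complex and xs n
    by (induction xs arbitrary: c) (simp_all add: mult.assoc)
  then show ?thesis
    by (simp add: hypergeometric_def eval_fps_def)
qed

end

theory Submission
  imports Defs "HOL-Complex_Analysis.Cauchy_Integral_Theorem"
begin

text \<open>
  With \<open>x\<^sub>j = cis t\<^sub>j\<close>, \<open>P = \<Prod> cos t\<^sub>j\<close> and \<open>q = 2\<^sup>r / k\<close>, the integrand is \<open>\<bar>k\<bar>\<^sup>s (1 + q P)\<^sup>s\<close>.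
  For \<open>\<bar>q\<bar> \<le> 1\<close> the binomial series of \<open>(1 + q P)\<^sup>s\<close> converges absolutely almost everywhere.
  Its coefficients are \<open>O(n powr (-Re s - 1))\<close>, while the mean of \<open>\<bar>P\<bar> ^ n\<close> is at most
  \<open>((1/2)\<^sub>m / m!) ^ r = O(n powr (-r/2))\<close> with \<open>m = n div 2\<close>.  So the series of the integrated norms
  converges as soon as \<open>\<bar>q\<bar> < 1\<close> or \<open>Re s > -r/2\<close>.  Termwise integration then yields both the
  convergence of the integral, which makes any continuation in \<open>s\<close> superfluous, and its value: only
  the even powers of \<open>P\<close> contribute, and they give the terms of the hypergeometric series.
\<close>

section \<open>Moments of the cosine over a full period\<close>

lemma set_integrable_cos_power: "set_integrable lborel {0..2*pi} (\<lambda>t. cos t ^ n)"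
  by (intro borel_integrable_atLeastAtMost' continuous_intros)

text \<open>The function \<open>cos t ^ Suc n * sin t\<close> vanishes at both ends of the interval.
  By \<open>sin_squared_eq\<close>, its derivative is a linear combination of the two powers of the
  cosine.\<close>

lemma cos_power_integral_rec:
  "(LBINT t:{0..2*pi}. cos t ^ Suc (Suc n)) =
     (real n + 1) / (real n + 2) * (LBINT t:{0..2*pi}. cos t ^ n)"
proof -
  define F where "F t = cos t ^ Suc n * sin t" for t :: real
  have deriv: "(F has_real_derivative (real n + 2) * cos t ^ Suc (Suc n) - (real n + 1) * cos t ^ n) (at t)" for t
  proof -
    have "(F has_real_derivative (real n + 1) * cos t ^ n * (- sin t) * sin t + cos t ^ Suc n * cos t) (at t)"
      unfolding F_def by (rule derivative_eq_intros refl | simp add: algebra_simps)+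
    also have "(real n + 1) * cos t ^ n * (- sin t) * sin t + cos t ^ Suc n * cos t =
        (real n + 1) * cos t ^ n * (- (sin t)\<^sup>2) + cos t ^ Suc (Suc n)"
      by (simp add: power2_eq_square)
    also have "\<dots> = (real n + 2) * cos t ^ Suc (Suc n) - (real n + 1) * cos t ^ n"
      unfolding sin_squared_eq by (simp add: algebra_simps power2_eq_square)
    finally show ?thesis .
  qed
  have "(LBINT t:{0..2*pi}. (real n + 2) * cos t ^ Suc (Suc n) - (real n + 1) * cos t ^ n) = F (2*pi) - F 0"
    unfolding set_lebesgue_integral_def
    by (intro integral_FTC_Icc) (use deriv in \<open>auto intro!: continuous_intros
          simp: has_real_derivative_iff_has_vector_derivative has_vector_derivative_at_within\<close>)
  also have "\<dots> = 0"
    by (simp add: F_def)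
  finally have "(real n + 2) * (LBINT t:{0..2*pi}. cos t ^ Suc (Suc n)) =
      (real n + 1) * (LBINT t:{0..2*pi}. cos t ^ n)"
    using set_integrable_cos_power[of n] set_integrable_cos_power[of "Suc (Suc n)"] by (subst (asm) set_integral_diff) simp_all
  then show ?thesis
    by (simp add: field_simps)
qed

lemma cos_power_integral:
  "(LBINT t:{0..2*pi}. cos t ^ n) =
     (if even n then 2 * pi * (pochhammer (1/2) (n div 2) / fact (n div 2)) else 0)"
proof (induction n rule: nat_induct2)
  case 0
  show ?case by (simp add: set_lebesgue_integral_def)
next
  case 1
  have "(LBINT t:{0..2*pi}. cos t) = sin (2*pi) - sin 0"
    unfolding set_lebesgue_integral_def
    by (intro integral_FTC_Icc) (auto intro!: continuous_intros derivative_eq_intros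
          simp flip: has_real_derivative_iff_has_vector_derivative)
  then show ?case by simp
next
  case (step n)
  \<comment> \<open>The factor of the recursion, written as the quotient of consecutive values of
    \<open>pochhammer (1/2) m / fact m\<close>.\<close>
  have "(real n + 1) / (real n + 2) = (1/2 + real m) / (1 + real m)" if "n = 2 * m" for m
    using that by (simp add: field_simps)
  note ratio = this
  show ?case
  proof (cases "even n")
    case True
    then obtain m where m: "n = 2 * m" by (elim evenE)
    show ?thesis
      unfolding add_2_eq_Suc' cos_power_integral_rec step ratio[OF m]
      using m by (simp add: pochhammer_rec' divide_simps)
  next
    case False
    then show ?thesis
      unfolding add_2_eq_Suc' cos_power_integral_rec step by simp
  qed
qed

section \<open>Decay of the even moments\<close>

text \<open>A Wallis-type bound. The weight \<open>2 * real m + 1\<close> makes the induction close: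
  from \<open>m\<close> to \<open>Suc m\<close> the left side gains the factor
  \<open>(2m+1)(2m+3) / (2m+2)^2\<close>, whose numerator is \<open>(2m+2)^2 - 1\<close>.\<close>

lemma pochhammer_half_square_le:
  "(pochhammer (1/2) m / fact m)\<^sup>2 * (2 * real m + 1) \<le> 1"
proof (induction m)
  case 0
  show ?case by simp
next
  case (Suc m)
  define w :: real where "w = pochhammer (1/2) m / fact m"
  have "(pochhammer (1/2) (Suc m) / fact (Suc m))\<^sup>2 * (2 * real (Suc m) + 1) =
      (w\<^sup>2 * (2 * real m + 1)) * ((2 * real m + 1) * (2 * real m + 3) / (2 * real m + 2)\<^sup>2)"
    by (simp add: w_def pochhammer_rec' field_simps power2_eq_square)
  also have "\<dots> \<le> 1 * 1"
  proof (rule mult_mono)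
    show "w\<^sup>2 * (2 * real m + 1) \<le> 1"
      using Suc by (simp add: w_def)
    show "(2 * real m + 1) * (2 * real m + 3) / (2 * real m + 2)\<^sup>2 \<le> 1"
      by (subst divide_le_eq_1_pos) (auto simp: power2_eq_square algebra_simps add_pos_nonneg)
  qed simp_all
  finally show ?case by simp
qed

text \<open>Since \<open>n \<le> 2 * (n div 2) + 1\<close>, the Wallis-type bound gives a decay in
  \<open>n\<close> itself, for either parity. At \<open>n = 0\<close> the right side would be
  \<open>0\<close> and the left side \<open>1\<close>.\<close>

lemma pochhammer_half_le_powr:
  assumes "n > 0"
  shows "pochhammer (1/2) (n div 2) / fact (n div 2) \<le> real n powr (- 1/2)"
proof -
  define w :: real where "w = pochhammer (1/2) (n div 2) / fact (n div 2)"
  have "w\<^sup>2 * real n \<le> w\<^sup>2 * (2 * real (n div 2) + 1)"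
    by (intro mult_left_mono) (linarith, simp)
  also have "\<dots> \<le> 1"
    unfolding w_def by (rule pochhammer_half_square_le)
  finally have "w \<le> sqrt (1 / real n)"
    using assms by (intro real_le_rsqrt) (simp add: field_simps)
  also have "\<dots> = real n powr (- 1/2)"
    using assms by (simp add: powr_minus powr_half_sqrt real_sqrt_divide field_simps)
  finally show ?thesis by (simp add: w_def)
qed

lemma pochhammer_half_le_1: "pochhammer (1/2) m / fact m \<le> (1::real)"
proof -
  define w :: real where "w = pochhammer (1/2) m / fact m"
  have "w\<^sup>2 * 1 \<le> w\<^sup>2 * (2 * real m + 1)"
    by (intro mult_left_mono) simp_all
  also have "\<dots> \<le> 1"
    unfolding w_def by (rule pochhammer_half_square_le)
  finally have "w \<le> 1"
    by (intro power2_le_imp_le[of w 1]) simp_all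
  then show ?thesis
    by (simp add: w_def)
qed

section \<open>Growth of the binomial coefficients and summability of the majorant\<close>

text \<open>By the Gamma asymptotics of the binomial coefficient, the quotient of the two sequences
  has a finite limit. The limit is \<open>0\<close> when \<open>s\<close> is a natural number, so
  only an upper bound is claimed.\<close>

lemma gbinomial_bigo:
  fixes s :: complex
  shows "(\<lambda>n. norm (s gchoose n)) \<in> O(\<lambda>n. real n powr (- Re s - 1))"
proof (rule bigoI_tendsto)
  show "\<forall>\<^sub>F n in sequentially. real n powr (- Re s - 1) \<noteq> 0"
    using eventually_gt_at_top[of 0] by eventually_elim simp
  show "(\<lambda>n. norm (s gchoose n) / real n powr (- Re s - 1)) \<longlonglongrightarrow> norm (inverse (Gamma (- s)))"
  proof (rule Lim_transform_eventually[OF tendsto_norm[OF gbinomial_asymptotic]])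
    show "\<forall>\<^sub>F n in sequentially.
        norm ((s gchoose n) / ((-1) ^ n / exp ((s + 1) * complex_of_real (ln (real n))))) =
        norm (s gchoose n) / real n powr (- Re s - 1)"
      using eventually_gt_at_top[of 0]
      by eventually_elim
        (simp add: norm_divide norm_mult norm_power powr_def algebra_simps exp_minus exp_diff exp_add field_simps)
  qed
qed

text \<open>The majorant for termwise integration. For \<open>\<bar>q\<bar> < 1\<close> the binomial
  series converges absolutely and bounding the moments by \<open>1\<close> suffices; for
  \<open>\<bar>q\<bar> = 1\<close> their decay has to supply the missing power of
  \<open>n\<close>.\<close>

lemma summable_binomial_moments:
  fixes s :: complex and q :: real
  assumes "\<bar>q\<bar> < 1 \<or> \<bar>q\<bar> = 1 \<and> Re s > - real r / 2"
  shows "summable (\<lambda>n. norm (s gchoose n) * \<bar>q\<bar> ^ n * (pochhammer (1/2) (n div 2) / fact (n div 2)) ^ r)"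
  using assms
proof
  assume q: "\<bar>q\<bar> < 1"
  have "summable (\<lambda>n. norm ((s gchoose n) * of_real q ^ n))"
    using q by (intro abs_summable_in_conv_radius) (simp add: conv_radius_gchoose)
  then show ?thesis
  proof (rule summable_comparison_test')
    show "norm (norm (s gchoose n) * \<bar>q\<bar> ^ n * (pochhammer (1/2) (n div 2) / fact (n div 2)) ^ r)
        \<le> norm ((s gchoose n) * of_real q ^ n)" if "n \<ge> 0" for n
    proof -
      have "(pochhammer (1/2) (n div 2) / fact (n div 2)) ^ r \<le> (1::real)"
        by (intro power_le_one pochhammer_half_le_1) (simp add: pochhammer_nonneg)
      then have "norm (s gchoose n) * \<bar>q\<bar> ^ n * (pochhammer (1/2) (n div 2) / fact (n div 2)) ^ r
          \<le> norm (s gchoose n) * \<bar>q\<bar> ^ n * 1"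
        by (intro mult_left_mono) simp_all
      then show ?thesis
        by (simp add: norm_mult norm_power abs_mult power_abs pochhammer_nonneg)
    qed
  qed
next
  assume q: "\<bar>q\<bar> = 1 \<and> Re s > - real r / 2"
  have "(\<lambda>n. (pochhammer (1/2) (n div 2) / fact (n div 2)) ^ r) \<in> O(\<lambda>n. (real n powr (- 1/2)) ^ r)"
  proof (rule bigoI[of _ 1])
    show "\<forall>\<^sub>F n in sequentially. norm ((pochhammer (1/2) (n div 2) / fact (n div 2)) ^ r :: real)
        \<le> 1 * norm ((real n powr (- 1/2)) ^ r)"
      using eventually_gt_at_top[of 0]
    proof eventually_elim
      case (elim n)
      then show ?case
        using power_mono[OF pochhammer_half_le_powr[OF elim], of r]
        by (simp add: pochhammer_nonneg)
    qed
  qed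
  with gbinomial_bigo[of s]
  have "(\<lambda>n. norm (s gchoose n) * (pochhammer (1/2) (n div 2) / fact (n div 2)) ^ r)
      \<in> O(\<lambda>n. real n powr (- Re s - 1) * (real n powr (- 1/2)) ^ r)"
    by (rule landau_o.big.mult)
  also have "(\<lambda>n. real n powr (- Re s - 1) * (real n powr (- 1/2)) ^ r) =
      (\<lambda>n. real n powr (- Re s - 1 - real r / 2))"
  proof
    fix n :: nat
    have "(real n powr (- 1/2)) ^ r = real n powr (- real r / 2)" if "n > 0"
      using that by (simp add: powr_powr flip: powr_realpow)
    moreover have "- Re s - 1 - real r / 2 = (- Re s - 1) + (- real r / 2)"
      by simp
    \<comment> \<open>At \<open>n = 0\<close> both sides are \<open>0\<close>, because
      \<open>0 powr x = 0\<close>.\<close>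
    ultimately show "real n powr (- Re s - 1) * (real n powr (- 1/2)) ^ r = real n powr (- Re s - 1 - real r / 2)"
      by (cases "n = 0") (simp_all only: powr_add, simp_all)
  qed
  finally have bigo: "(\<lambda>n. norm (s gchoose n) * (pochhammer (1/2) (n div 2) / fact (n div 2)) ^ r)
      \<in> O(\<lambda>n. real n powr (- Re s - 1 - real r / 2))" .
  \<comment> \<open>The exponent is below \<open>-1\<close> exactly when
    \<open>Re s > - real r / 2\<close>.\<close>
  have "summable (\<lambda>n. norm (real n powr (- Re s - 1 - real r / 2)))"
    using q by (simp add: summable_real_powr_iff)
  from summable_comparison_test_bigo[OF this bigo] show ?thesis
    using q by (simp only: power_one mult_1_right)
qed

section \<open>Integration over the torus\<close>

text \<open>The indicator of the box is the product of the indicators of its sides, so Fubini for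
  finite products applies.\<close>

lemma torus_integral_prod:
  fixes f :: "real \<Rightarrow> 'a :: {real_normed_field, banach, second_countable_topology}"
  assumes "set_integrable lborel {0..2*pi} f"
  shows "set_integrable (torus_measure r) (torus_box r) (\<lambda>t. \<Prod>j<r. f (t j))"
    and "set_lebesgue_integral (torus_measure r) (torus_box r) (\<lambda>t. \<Prod>j<r. f (t j)) =
           (LBINT t:{0..2*pi}. f t) ^ r"
proof -
  interpret product_sigma_finite "\<lambda>_::nat. lborel :: real measure" ..
  \<comment> \<open>Points of the space are extensional on \<open>{..<r}\<close>, so one that lies
    outside the box must leave the interval in some coordinate \<open>j < r\<close>.\<close>
  have eq: "indicator (torus_box r) t *\<^sub>R (\<Prod>j<r. f (t j)) =
      (\<Prod>j<r. indicator {0..2*pi} (t j) *\<^sub>R f (t j))" if t: "t \<in> space (torus_measure r)" for t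
  proof (cases "t \<in> torus_box r")
    case True
    then have "t j \<in> {0..2*pi}" if "j < r" for j
      using that by (auto simp: torus_box_def PiE_iff)
    then show ?thesis
      using True by simp
  next
    case False
    then obtain j where "j < r" "t j \<notin> {0..2*pi}"
      using t by (auto simp: torus_measure_def space_PiM torus_box_def PiE_iff)
    then have "(\<Prod>j<r. indicator {0..2*pi} (t j) *\<^sub>R f (t j)) = 0"
      by (intro prod_zero) (auto intro!: bexI[of _ j])
    then show ?thesis
      using False by simp
  qed
  show "set_integrable (torus_measure r) (torus_box r) (\<lambda>t. \<Prod>j<r. f (t j))"
    using assms unfolding set_integrable_def
    by (subst Bochner_Integration.integrable_cong[OF refl eq])
      (auto simp: torus_measure_def intro!: product_integrable_prod)
  have "(\<integral>t. (\<Prod>j<r. indicator {0..2*pi} (t j) *\<^sub>R f (t j)) \<partial>torus_measure r) =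
      (\<Prod>j<r. LBINT t:{0..2*pi}. f t)"
    using assms unfolding torus_measure_def set_lebesgue_integral_def set_integrable_def
    by (intro product_integral_prod) auto
  then show "set_lebesgue_integral (torus_measure r) (torus_box r) (\<lambda>t. \<Prod>j<r. f (t j)) =
      (LBINT t:{0..2*pi}. f t) ^ r"
    by (simp add: set_lebesgue_integral_def Bochner_Integration.integral_cong[OF refl eq])
qed

text \<open>The product can have modulus \<open>1\<close> only if its factor with index
  \<open>0\<close> does, which confines \<open>t 0\<close> to three values.\<close>

lemma AE_torus_prod_cos_less_1:
  assumes "r \<ge> 1"
  shows "AE t in torus_measure r. t \<in> torus_box r \<longrightarrow> \<bar>\<Prod>j<r. cos (t j)\<bar> < 1"
proof -
  interpret product_sigma_finite "\<lambda>_::nat. lborel :: real measure" ..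
  \<comment> \<open>A cylinder over three points. Its measure is a product with one factor
    \<open>0\<close>; the other factors are infinite, but \<open>0\<close> times infinity is
    \<open>0\<close> in the extended nonnegative reals.\<close>
  define N where "N = (\<Pi>\<^sub>E j\<in>{..<r}. if j = 0 then {0, pi, 2*pi} else (UNIV :: real set))"
  have "emeasure (torus_measure r) N =
      (\<Prod>j<r. emeasure lborel (if j = 0 then {0, pi, 2*pi} else (UNIV :: real set)))"
    unfolding torus_measure_def N_def by (rule emeasure_PiM) auto
  also have "\<dots> = 0"
    using assms by (intro prod_zero bexI[of _ 0]) (auto simp: emeasure_lborel_countable)
  finally have "N \<in> null_sets (torus_measure r)"
    by (auto simp: torus_measure_def N_def intro!: sets_PiM_I_finite)
  then have "AE t in torus_measure r. t \<notin> N"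
    by (rule AE_not_in)
  moreover have "t \<in> N" if "t \<in> torus_box r" "t 0 \<in> {0, pi, 2*pi}" for t
    using that by (auto simp: N_def torus_box_def PiE_iff)
  ultimately have "AE t in torus_measure r. t \<in> torus_box r \<longrightarrow> t 0 \<notin> {0, pi, 2*pi}"
    by (auto elim: eventually_mono)
  then show ?thesis
  proof (eventually_elim, intro impI)
    fix t :: "nat \<Rightarrow> real"
    assume t0: "t \<in> torus_box r \<longrightarrow> t 0 \<notin> {0, pi, 2*pi}" and t: "t \<in> torus_box r"
    then have "t 0 \<in> {0..2*pi}"
      using assms by (auto simp: torus_box_def PiE_iff)
    then have "sin (t 0) \<noteq> 0"
      using t t0 sin_gt_zero[of "t 0"] sin_lt_zero[of "t 0"] by force
    then have "\<bar>cos (t 0)\<bar> < 1"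
      by (subst abs_square_less_1[symmetric]) (simp add: cos_squared_eq)
    have "(\<Prod>j<r. \<bar>cos (t j)\<bar>) = \<bar>cos (t 0)\<bar> * (\<Prod>j\<in>{..<r} - {0}. \<bar>cos (t j)\<bar>)"
      using assms by (intro prod.remove) auto
    also have "\<dots> \<le> \<bar>cos (t 0)\<bar> * 1"
      by (intro mult_left_mono prod_le_1) auto
    finally show "\<bar>\<Prod>j<r. cos (t j)\<bar> < 1"
      using \<open>\<bar>cos (t 0)\<bar> < 1\<close> by (simp add: abs_prod)
  qed
qed

lemma
  shows set_integrable_prod_cos_power:
      "set_integrable (torus_measure r) (torus_box r) (\<lambda>t. (\<Prod>j<r. cos (t j)) ^ n)"
    and set_integral_prod_cos_power:
      "set_lebesgue_integral (torus_measure r) (torus_box r) (\<lambda>t. (\<Prod>j<r. cos (t j)) ^ n) =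
         (LBINT t:{0..2*pi}. cos t ^ n) ^ r"
  using torus_integral_prod[OF set_integrable_cos_power[of n], of r] by (simp_all add: prod_power_distrib)

text \<open>Lowering the exponent to the even number \<open>2 * (n div 2)\<close> can only increase
  \<open>\<bar>cos t\<bar> ^ n\<close>, and it removes the absolute value, so the even moments bound
  the absolute ones.\<close>

lemma set_integral_abs_prod_cos_power_le:
  "set_lebesgue_integral (torus_measure r) (torus_box r) (\<lambda>t. \<bar>\<Prod>j<r. cos (t j)\<bar> ^ n) \<le>
     (2 * pi) ^ r * (pochhammer (1/2) (n div 2) / fact (n div 2)) ^ r"
proof -
  have int: "set_integrable lborel {0..2*pi} (\<lambda>t. \<bar>cos t\<bar> ^ n)"
    by (intro borel_integrable_atLeastAtMost' continuous_intros)
  have "(LBINT t:{0..2*pi}. \<bar>cos t\<bar> ^ n) \<le> (LBINT t:{0..2*pi}. cos t ^ (2 * (n div 2)))"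
  proof (rule set_integral_mono[OF int set_integrable_cos_power])
    fix t :: real
    have "\<bar>cos t\<bar> ^ n \<le> \<bar>cos t\<bar> ^ (2 * (n div 2))"
      by (intro power_decreasing) auto
    then show "\<bar>cos t\<bar> ^ n \<le> cos t ^ (2 * (n div 2))"
      by (subst (asm) (2) power_even_abs) simp_all
  qed
  then have "(LBINT t:{0..2*pi}. \<bar>cos t\<bar> ^ n) ^ r \<le>
      (2 * pi * (pochhammer (1/2) (n div 2) / fact (n div 2))) ^ r"
    unfolding cos_power_integral
    by (intro power_mono) (auto simp: set_lebesgue_integral_def intro!: integral_nonneg_AE)
  moreover have "set_lebesgue_integral (torus_measure r) (torus_box r) (\<lambda>t. \<bar>\<Prod>j<r. cos (t j)\<bar> ^ n) =
      (LBINT t:{0..2*pi}. \<bar>cos t\<bar> ^ n) ^ r"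
    using torus_integral_prod(2)[OF int, of r] by (simp add: prod_power_distrib abs_prod)
  ultimately show ?thesis
    by (simp only: power_mult_distrib)
qed

section \<open>Termwise integration of the binomial series\<close>

lemma
  fixes q :: real and s :: complex
  assumes r: "r \<ge> 1" and q: "\<bar>q\<bar> < 1 \<or> \<bar>q\<bar> = 1 \<and> Re s > - real r / 2"
  defines "F \<equiv> (\<lambda>t. complex_of_real (1 + q * (\<Prod>j<r. cos (t j))) powr s)"
  shows set_integrable_binomial_cos: "set_integrable (torus_measure r) (torus_box r) F"
    and sums_integral_binomial_cos:
      "(\<lambda>n. (s gchoose n) * of_real (q ^ n * (LBINT t:{0..2*pi}. cos t ^ n) ^ r))
         sums set_lebesgue_integral (torus_measure r) (torus_box r) F"
proof -
  define P where "P t = (\<Prod>j<r. cos (t j))" for t :: "nat \<Rightarrow> real"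
  define M where "M = torus_measure r"
  define f where "f n t = indicator (torus_box r) t *\<^sub>R ((s gchoose n) * of_real (q * P t) ^ n)" for n t
  have f_eq: "f n t = ((s gchoose n) * of_real (q ^ n)) * of_real (indicator (torus_box r) t *\<^sub>R P t ^ n)" for n t
    by (simp add: f_def scaleR_conv_of_real power_mult_distrib mult_ac)
  have f_norm: "norm (f n t) = (norm (s gchoose n) * \<bar>q\<bar> ^ n) * (indicator (torus_box r) t *\<^sub>R \<bar>P t\<bar> ^ n)" for n t
    by (simp add: f_def norm_mult norm_power power_mult_distrib abs_mult mult_ac)
  have int_f: "integrable M (f n)" for n
    using set_integrable_prod_cos_power[of r n] unfolding f_eq set_integrable_def M_def P_def
    by (intro integrable_mult_right integrable_of_real)
  \<comment> \<open>For \<open>\<bar>q\<bar> = 1\<close> the series may diverge where the product of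
    cosines has modulus \<open>1\<close>; these points form a null set.\<close>
  have AE_less: "AE t in M. t \<in> torus_box r \<longrightarrow> \<bar>q * P t\<bar> < 1"
    using AE_torus_prod_cos_less_1[OF r] unfolding M_def
  proof eventually_elim
    case (elim t)
    have "\<bar>q\<bar> * \<bar>P t\<bar> \<le> 1 * \<bar>P t\<bar>"
      using q by (intro mult_right_mono) auto
    then show ?case
      using elim by (auto simp: abs_mult P_def)
  qed
  have AE_summable: "AE t in M. summable (\<lambda>n. norm (f n t))"
    using AE_less
  proof eventually_elim
    case (elim t)
    have "summable (\<lambda>n. norm ((s gchoose n) * of_real (q * P t) ^ n))" if "\<bar>q * P t\<bar> < 1"
      using that by (intro abs_summable_in_conv_radius) (simp add: conv_radius_gchoose del: of_real_mult)
    then show ?case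
      using elim by (cases "t \<in> torus_box r") (simp_all add: f_def)
  qed
  have summable_int: "summable (\<lambda>n. \<integral>t. norm (f n t) \<partial>M)"
  proof (rule summable_comparison_test')
    show "summable (\<lambda>n. (2 * pi) ^ r *
        (norm (s gchoose n) * \<bar>q\<bar> ^ n * (pochhammer (1/2) (n div 2) / fact (n div 2)) ^ r))"
      by (intro summable_mult summable_binomial_moments q)
  next
    fix n :: nat
    have "norm (\<integral>t. norm (f n t) \<partial>M) = (\<integral>t. norm (f n t) \<partial>M)"
      by (simp add: integral_nonneg_AE)
    also have "\<dots> = (norm (s gchoose n) * \<bar>q\<bar> ^ n) *
        set_lebesgue_integral M (torus_box r) (\<lambda>t. \<bar>P t\<bar> ^ n)"
      unfolding f_norm set_lebesgue_integral_def by (rule integral_mult_right_zero)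
    also have "\<dots> \<le> (norm (s gchoose n) * \<bar>q\<bar> ^ n) *
        ((2 * pi) ^ r * (pochhammer (1/2) (n div 2) / fact (n div 2)) ^ r)"
      unfolding P_def M_def by (intro mult_left_mono set_integral_abs_prod_cos_power_le) simp
    finally show "norm (\<integral>t. norm (f n t) \<partial>M) \<le> (2 * pi) ^ r *
        (norm (s gchoose n) * \<bar>q\<bar> ^ n * (pochhammer (1/2) (n div 2) / fact (n div 2)) ^ r)"
      by (simp only: mult_ac)
  qed
  \<comment> \<open>The sum of the series agrees with \<open>F\<close> only almost everywhere, so
    measurability of \<open>F\<close> is shown separately before integrability is
    transferred.\<close>
  have [measurable]: "(\<lambda>t. indicator (torus_box r) t *\<^sub>R F t) \<in> borel_measurable M"
  proof -
    have [measurable]: "torus_box r \<in> sets M"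
      unfolding torus_box_def M_def torus_measure_def by (intro sets_PiM_I_finite) auto
    have [measurable]: "(\<lambda>t. t j) \<in> borel_measurable M" if "j \<in> {..<r}" for j
      using that unfolding M_def torus_measure_def by simp
    show ?thesis
      unfolding F_def by measurable
  qed
  have AE_eq: "AE t in M. (\<Sum>n. f n t) = indicator (torus_box r) t *\<^sub>R F t"
    using AE_less
  proof eventually_elim
    case (elim t)
    show ?case
    proof (cases "t \<in> torus_box r")
      case True
      then have "norm (complex_of_real (q * P t)) < 1"
        using elim by (simp del: of_real_mult)
      from sums_unique[OF gen_binomial_complex[OF this, of s]] show ?thesis
        using True by (simp add: f_def F_def P_def)
    qed (simp add: f_def)
  qed
  have int_sum: "integrable M (\<lambda>t. \<Sum>n. f n t)"
    by (rule integrable_suminf[OF int_f AE_summable summable_int])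
  then show "set_integrable (torus_measure r) (torus_box r) F"
    using AE_eq unfolding set_integrable_def M_def[symmetric]
    by (elim integrable_cong_AE_imp) auto
  have "(\<lambda>n. \<integral>t. f n t \<partial>M) sums (\<integral>t. (\<Sum>n. f n t) \<partial>M)"
    by (rule sums_integral[OF int_f AE_summable summable_int])
  also have "(\<integral>t. (\<Sum>n. f n t) \<partial>M) = set_lebesgue_integral M (torus_box r) F"
    using AE_eq borel_measurable_integrable[OF int_sum] unfolding set_lebesgue_integral_def
    by (intro integral_cong_AE) auto
  also have "(\<lambda>n. \<integral>t. f n t \<partial>M) =
      (\<lambda>n. (s gchoose n) * of_real (q ^ n * (LBINT t:{0..2*pi}. cos t ^ n) ^ r))"
    unfolding f_eq integral_mult_right_zero integral_complex_of_real
    using set_integral_prod_cos_power[of r]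
    by (simp add: set_lebesgue_integral_def P_def M_def mult.assoc)
  finally show "(\<lambda>n. (s gchoose n) * of_real (q ^ n * (LBINT t:{0..2*pi}. cos t ^ n) ^ r))
      sums set_lebesgue_integral (torus_measure r) (torus_box r) F"
    by (simp add: M_def)
qed

section \<open>From the even binomial terms to the hypergeometric series\<close>

text \<open>The duplication formula splits both \<open>pochhammer (- s) (2 * m)\<close> and
  \<open>fact (2 * m)\<close>, and the powers of \<open>2\<close> cancel. The factor
  \<open>pochhammer (1/2) m\<close> left in the denominator cancels one of the \<open>r\<close> in
  the numerator, whence the \<open>r - 1\<close> upper parameters \<open>1/2\<close>.\<close>

lemma hypergeometric_eq_suminf_gbinomial:
  fixes s z :: complex
  assumes "r \<ge> 1"
  shows "hypergeometric ([- s / 2, (1 - s) / 2] @ replicate (r - 1) (1 / 2)) (replicate r 1) z =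
    (\<Sum>m. (s gchoose (2 * m)) * (pochhammer (1/2) m / fact m) ^ r * z ^ m)"
  unfolding hypergeometric_series
proof (rule suminf_cong)
  fix m :: nat
  define p :: complex where "p = pochhammer (1/2) m"
  have "p \<noteq> 0"
  proof
    assume "p = 0"
    then obtain i where "(1 / 2 :: complex) = - of_nat i"
      by (auto simp: p_def pochhammer_eq_0_iff)
    from arg_cong[OF this, of Re] show False by simp
  qed
  have "s gchoose (2 * m) = pochhammer (2 * (- s / 2)) (2 * m) / fact (2 * m)"
    by (simp add: gbinomial_pochhammer)
  also have "\<dots> = pochhammer (- s / 2) m * pochhammer (- s / 2 + 1 / 2) m / (p * fact m)"
    unfolding pochhammer_double fact_double by (simp add: p_def)
  also have "- s / 2 + 1 / 2 = (1 - s) / 2"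
    by (simp add: field_simps)
  finally have gb: "s gchoose (2 * m) = pochhammer (- s / 2) m * pochhammer ((1 - s) / 2) m / (p * fact m)" .
  obtain r' where "r = Suc r'"
    using assms by (cases r) auto
  then show "(\<Prod>a\<leftarrow>[- s / 2, (1 - s) / 2] @ replicate (r - 1) (1 / 2). pochhammer a m) /
      (\<Prod>b\<leftarrow>replicate r 1. pochhammer b m) * z ^ m / fact m =
      (s gchoose (2 * m)) * (pochhammer (1/2) m / fact m) ^ r * z ^ m"
    using \<open>p \<noteq> 0\<close> unfolding gb p_def[symmetric]
    by (simp add: p_def[symmetric] pochhammer_fact[symmetric] map_replicate prod_list_replicate power_divide)
qed

text \<open>The factors \<open>1 / x j\<close> cancel against
  \<open>dx j = \<i> * x j * dt j\<close> and leave \<open>\<i> ^ r\<close>. The bound on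
  \<open>2 ^ r / k\<close> makes \<open>1 + 2 ^ r / k * P\<close> nonnegative, so the modulus opens
  and the complex power splits, also where the base vanishes.\<close>

lemma torus_pullback_W_integrand:
  assumes "k \<noteq> 0" and q: "\<bar>2 ^ r / k\<bar> \<le> 1"
  shows "torus_pullback r (W_integrand r k s) t =
    \<i> ^ r * of_real \<bar>k\<bar> powr s * of_real (1 + 2 ^ r / k * (\<Prod>j<r. cos (t j))) powr s"
proof -
  define P where "P = (\<Prod>j<r. cos (t j))"
  have "(\<Prod>j<r. cis (t j) + inverse (cis (t j))) = (\<Prod>j<r. of_real (2 * cos (t j)))"
    by (intro prod.cong) (auto simp: complex_eq_iff)
  also have "\<dots> = of_real (2 ^ r * P)"
    by (simp add: P_def prod.distrib)
  finally have "complex_of_real k + (\<Prod>j<r. cis (t j) + inverse (cis (t j))) = of_real (k + 2 ^ r * P)"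
    by simp
  then have "cmod (of_real k + (\<Prod>j<r. cis (t j) + inverse (cis (t j)))) = \<bar>k + 2 ^ r * P\<bar>"
    by (metis norm_of_real)
  also have "k + 2 ^ r * P = k * (1 + 2 ^ r / k * P)"
    using assms by (simp add: field_simps)
  finally have norm_eq: "cmod (of_real k + (\<Prod>j<r. cis (t j) + inverse (cis (t j)))) =
      \<bar>k\<bar> * \<bar>1 + 2 ^ r / k * P\<bar>"
    by (simp only: abs_mult)
  have "\<bar>P\<bar> \<le> 1"
    unfolding P_def abs_prod by (intro prod_le_1) auto
  with q have "\<bar>2 ^ r / k * P\<bar> \<le> 1 * 1"
    unfolding abs_mult by (intro mult_mono) auto
  then have nonneg: "1 + 2 ^ r / k * P \<ge> 0"
    by linarith
  have prod_eq: "(\<Prod>j<r. 1 / cis (t j)) * (\<Prod>j<r. \<i> * cis (t j)) = \<i> ^ r"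
    by (simp flip: prod.distrib)
  have "torus_pullback r (W_integrand r k s) t =
      ((\<Prod>j<r. 1 / cis (t j)) * (\<Prod>j<r. \<i> * cis (t j))) *
      of_real (\<bar>k\<bar> * (1 + 2 ^ r / k * P)) powr s"
    unfolding torus_pullback_def W_integrand_def norm_eq abs_of_nonneg[OF nonneg]
    by (simp only: mult_ac)
  also note prod_eq
  also have "of_real (\<bar>k\<bar> * (1 + 2 ^ r / k * P)) powr s =
      of_real \<bar>k\<bar> powr s * of_real (1 + 2 ^ r / k * P) powr s"
    unfolding of_real_mult using nonneg by (intro powr_times_real) auto
  finally show ?thesis
    by (simp add: P_def mult.assoc)
qed

text \<open>Both regimes of \<open>k\<close> are treated at once through
  \<open>q = 2 ^ r / k\<close>: they correspond to \<open>\<bar>q\<bar> < 1\<close> and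
  \<open>\<bar>q\<bar> = 1\<close>.\<close>

lemma W_eq_hypergeometric:
  assumes r: "r \<ge> 1" and k: "\<bar>k\<bar> > 2 ^ r \<or> \<bar>k\<bar> = 2 ^ r \<and> Re s > - real r / 2"
  shows "W r k s = complex_of_real \<bar>k\<bar> powr s *
    hypergeometric ([- s / 2, (1 - s) / 2] @ replicate (r - 1) (1 / 2)) (replicate r 1)
      (complex_of_real (4 ^ r / k ^ 2))"
proof -
  define q where "q = 2 ^ r / k"
  define F where "F t = complex_of_real (1 + q * (\<Prod>j<r. cos (t j))) powr s" for t :: "nat \<Rightarrow> real"
  define c where "c = \<i> ^ r * complex_of_real \<bar>k\<bar> powr s"
  have "\<bar>k\<bar> > 0"
    using k by (elim disjE) (auto intro: less_trans[of 0 "2 ^ r"])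
  then have "k \<noteq> 0" and q: "\<bar>q\<bar> < 1 \<or> \<bar>q\<bar> = 1 \<and> Re s > - real r / 2"
    using k by (auto simp: q_def)
  then have pullback: "torus_pullback r (W_integrand r k s) = (\<lambda>t. c * F t)"
    using torus_pullback_W_integrand[of k r s] by (auto simp: q_def c_def F_def)
  have F_int: "set_integrable (torus_measure r) (torus_box r) F"
    using set_integrable_binomial_cos[OF r q] unfolding F_def .
  let ?w = "\<lambda>m. pochhammer (1/2) m / fact m"
  have "(\<lambda>n. (s gchoose n) * of_real (q ^ n * (LBINT t:{0..2*pi}. cos t ^ n) ^ r))
      sums set_lebesgue_integral (torus_measure r) (torus_box r) F"
    using sums_integral_binomial_cos[OF r q] unfolding F_def .
  then have "(\<lambda>m. (s gchoose (2 * m)) * of_real (q ^ (2 * m) * (LBINT t:{0..2*pi}. cos t ^ (2 * m)) ^ r))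
      sums set_lebesgue_integral (torus_measure r) (torus_box r) F"
  \<comment> \<open>Odd moments are \<open>0\<close>, and so are their \<open>r\<close>-th powers
    since \<open>r \<ge> 1\<close>; only the indices \<open>2 * m\<close> remain.\<close>
  proof (subst sums_mono_reindex[of "\<lambda>m. 2 * m"])
    fix n :: nat assume "n \<notin> range (\<lambda>m. 2 * m)"
    then have "odd n"
      by (auto elim!: evenE)
    then show "(s gchoose n) * of_real (q ^ n * (LBINT t:{0..2*pi}. cos t ^ n) ^ r) = 0"
      using r by (simp add: cos_power_integral)
  qed (auto simp: strict_mono_def)
  also have "(\<lambda>m. (s gchoose (2 * m)) * of_real (q ^ (2 * m) * (LBINT t:{0..2*pi}. cos t ^ (2 * m)) ^ r)) =
      (\<lambda>m. (2 * of_real pi) ^ r * ((s gchoose (2 * m)) * ?w m ^ r * of_real (4 ^ r / k ^ 2) ^ m))"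
  proof
    fix m
    have "q ^ 2 = 4 ^ r / k ^ 2"
      by (simp add: q_def power2_eq_square flip: power_mult_distrib)
    then have "q ^ (2 * m) = (4 ^ r / k ^ 2) ^ m"
      by (simp only: power_mult)
    moreover have "complex_of_real (LBINT t:{0..2*pi}. cos t ^ (2 * m)) = 2 * of_real pi * ?w m"
      unfolding cos_power_integral by (simp flip: pochhammer_of_real)
    then have "complex_of_real ((LBINT t:{0..2*pi}. cos t ^ (2 * m)) ^ r) = (2 * of_real pi) ^ r * ?w m ^ r"
      by (simp only: of_real_power power_mult_distrib)
    ultimately show "(s gchoose (2 * m)) * of_real (q ^ (2 * m) * (LBINT t:{0..2*pi}. cos t ^ (2 * m)) ^ r) =
        (2 * of_real pi) ^ r * ((s gchoose (2 * m)) * ?w m ^ r * of_real (4 ^ r / k ^ 2) ^ m)"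
      by (simp only: of_real_mult of_real_power mult_ac)
  qed
  finally have sums: "(\<lambda>m. (2 * of_real pi) ^ r * ((s gchoose (2 * m)) * ?w m ^ r * of_real (4 ^ r / k ^ 2) ^ m))
      sums set_lebesgue_integral (torus_measure r) (torus_box r) F" .
  \<comment> \<open>Summability after division by the nonzero constant is what
    \<open>suminf_mult\<close> requires to pull that constant out.\<close>
  then have "summable (\<lambda>m. (s gchoose (2 * m)) * ?w m ^ r * complex_of_real (4 ^ r / k ^ 2) ^ m)"
    by (intro summable_mult_D[OF sums_summable[OF sums]]) simp
  then have "set_lebesgue_integral (torus_measure r) (torus_box r) F = (2 * of_real pi) ^ r *
      hypergeometric ([- s / 2, (1 - s) / 2] @ replicate (r - 1) (1 / 2)) (replicate r 1)
        (complex_of_real (4 ^ r / k ^ 2))"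
    unfolding hypergeometric_eq_suminf_gbinomial[OF r] sums_unique[OF sums] by (rule suminf_mult)
  then have "set_lebesgue_integral (torus_measure r) (torus_box r) F / (2 * of_real pi) ^ r =
      hypergeometric ([- s / 2, (1 - s) / 2] @ replicate (r - 1) (1 / 2)) (replicate r 1)
        (complex_of_real (4 ^ r / k ^ 2))"
    by simp
  \<comment> \<open>This selects the branch of \<open>W\<close> that is the integral itself.\<close>
  moreover have "torus_integrable r (W_integrand r k s)"
    using F_int unfolding torus_integrable_def pullback by simp
  then have "W r k s = 1 / (2 * of_real pi * \<i>) ^ r *
      (c * set_lebesgue_integral (torus_measure r) (torus_box r) F)"
    by (simp only: W_def W_integral_def torus_integral_def pullback if_True set_integral_mult_right)
  then have "W r k s = complex_of_real \<bar>k\<bar> powr s *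
      (set_lebesgue_integral (torus_measure r) (torus_box r) F / (2 * of_real pi) ^ r)"
    \<comment> \<open>The \<open>\<i> ^ r\<close> from the pullback cancels the one in the
      normalising factor.\<close>
    unfolding c_def power_mult_distrib[of _ \<i>] by simp
  ultimately show ?thesis
    by (simp only:)
qed

theorem theorem1p4:
  fixes r :: nat
  assumes "r \<ge> 1"
  shows "(\<forall>(k::real) (s::complex). \<bar>k\<bar> > 2 ^ r \<longrightarrow>
            W r k s = complex_of_real \<bar>k\<bar> powr s *
              hypergeometric ([- s / 2, (1 - s) / 2] @ replicate (r - 1) (1 / 2)) (replicate r 1)
                (complex_of_real (4 ^ r / k ^ 2))) \<and>
         (\<forall>(k::real) (s::complex). \<bar>k\<bar> = 2 ^ r \<and> Re s > - real r / 2 \<longrightarrow>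
            W r k s = 2 powr (of_nat r * s) *
              hypergeometric ([- s / 2, (1 - s) / 2] @ replicate (r - 1) (1 / 2)) (replicate r 1) 1)"
proof (intro conjI allI impI)
  fix k :: real and s :: complex
  assume k: "\<bar>k\<bar> = 2 ^ r \<and> Re s > - real r / 2"
  \<comment> \<open>On positive reals the principal logarithm is the real one, so the power
    \<open>r\<close> can be moved into the complex exponent without a branch correction.\<close>
  have "Ln (complex_of_real (2 ^ r)) = of_nat r * Ln (complex_of_real 2)"
    by (subst (1 2) Ln_of_real) (simp_all add: ln_realpow)
  then have powr_eq: "complex_of_real \<bar>k\<bar> powr s = 2 powr (of_nat r * s)"
    using k by (simp add: powr_def mult_ac)
  have "k ^ 2 = \<bar>k\<bar> ^ 2"
    by simp
  also have "\<dots> = 4 ^ r"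
    using k by (simp add: power2_eq_square flip: power_mult_distrib)
  finally have "k ^ 2 = 4 ^ r" .
  with powr_eq show "W r k s = 2 powr (of_nat r * s) *
      hypergeometric ([- s / 2, (1 - s) / 2] @ replicate (r - 1) (1 / 2)) (replicate r 1) 1"
    using W_eq_hypergeometric[OF assms, of k s] k by simp
qed (use W_eq_hypergeometric[OF assms] in blast)

end
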